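(* Let $\mathbb{F}$ be an algebraically closed field with $\mathrm{Char}(\mathbb{F})\neq 2,3$. For $\alpha_1,\beta_2\in\mathbb{F}$ let $A_4(\alpha_1,\beta_2)$ and $A_5(\alpha_1)$ be the binary algebras on $V=\mathbb{F}e_1\oplus\mathbb{F}e_2$ with matrices of structure constants $$A_4(\alpha_1,\beta_2)=\left(\begin{array}{cccc}\alpha_1&0&0&0\\0&\beta_2&1-\alpha_1&0\end{array}\right),\qquad A_5(\alpha_1)=\left(\begin{array}{cccc}\alpha_1&0&0&0\\1&2\alpha_1-1&1-\alpha_1&0\end{array}\right).$$ Then: (1) The algebras $A_4(\tfrac13,-\tfrac13)$ and $A_5(\tfrac13)$ are not isomorphic, but both generate the same $3$-algebra, with matrix of structure constants $$\left(\begin{array}{cccccccc}\frac19&0&0&0&0&0&0&0\\0&\frac19&-\frac29&0&\frac29&0&0&0\end{array}\right).$$ (2) The algebras $A_4(1,-1)$ and $A_4(1,1)$ are not isomorphic, but both generate the same $3$-algebra, with matrix of structure constants $$\left(\begin{array}{cccccccc}1&0&0&0&0&0&0&0\\0&1&0&0&0&0&0&0\end{array}\right).$$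
   Context: A binary algebra on $V$ is a bilinear map $\mu:V\times V\to V$; its matrix of structure constants is the $2\times 4$ matrix whose columns are the coordinate vectors (in the basis $e_1,e_2$) of $\mu(e_1,e_1),\mu(e_1,e_2),\mu(e_2,e_1),\mu(e_2,e_2)$ in this order. Two algebras are isomorphic if there is an invertible linear map $\varphi$ between them with $\varphi(\mu(x,y))=\mu'(\varphi(x),\varphi(y))$ for all $x,y$. A $3$-algebra is a vector space $V$ with a trilinear map $f:V\times V\times V\to V$. Its matrix of structure constants is the $2\times 8$ matrix whose columns, indexed by $(i,j,k)$ in the order $111,112,121,122,211,212,221,222$, are the coordinate vectors of $f(e_i,e_j,e_k)$. The $3$-algebra generated by $(V,\mu)$ is $(V,f_\mu)$ with $f_\mu(x,y,z)=\mu(x,\mu(y,z))$. *)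

theory Defs
  imports "HOL-Analysis.Cartesian_Space" "HOL-Computational_Algebra.Polynomial"
begin

text \<open>Algebras on the coordinate space \<open>V = 'a^2\<close> over a field \<open>'a\<close> are given by their
  multiplication maps. Linearity is always with respect to the scalar multiplication \<open>(*s)\<close>.\<close>

abbreviation linear_vec :: "('a::field^'n \<Rightarrow> 'a^'m) \<Rightarrow> bool"
  where "linear_vec \<equiv> Vector_Spaces.linear (*s) (*s)"

definition bilinear_vec :: "('a::field^'n \<Rightarrow> 'a^'n \<Rightarrow> 'a^'n) \<Rightarrow> bool"
  where "bilinear_vec \<mu> \<longleftrightarrow>
    (\<forall>y. linear_vec (\<lambda>x. \<mu> x y)) \<and> (\<forall>x. linear_vec (\<lambda>y. \<mu> x y))"

definition trilinear_vec :: "('a::field^'n \<Rightarrow> 'a^'n \<Rightarrow> 'a^'n \<Rightarrow> 'a^'n) \<Rightarrow> bool"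
  where "trilinear_vec f \<longleftrightarrow>
    (\<forall>y z. linear_vec (\<lambda>x. f x y z)) \<and>
    (\<forall>x z. linear_vec (\<lambda>y. f x y z)) \<and>
    (\<forall>x y. linear_vec (\<lambda>z. f x y z))"

definition isomorphic_algebras ::
    "('a::field^'n \<Rightarrow> 'a^'n \<Rightarrow> 'a^'n) \<Rightarrow> ('a^'m \<Rightarrow> 'a^'m \<Rightarrow> 'a^'m) \<Rightarrow> bool"
  where "isomorphic_algebras \<mu> \<mu>' \<longleftrightarrow>
    (\<exists>\<phi>. linear_vec \<phi> \<and> bij \<phi> \<and> (\<forall>x y. \<phi> (\<mu> x y) = \<mu>' (\<phi> x) (\<phi> y)))"

definition generated_3_algebra ::
    "('a::field^'n \<Rightarrow> 'a^'n \<Rightarrow> 'a^'n) \<Rightarrow> 'a^'n \<Rightarrow> 'a^'n \<Rightarrow> 'a^'n \<Rightarrow> 'a^'n"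
  where "generated_3_algebra \<mu> x y z = \<mu> x (\<mu> y z)"

abbreviation e1 :: "'a::field^2" where "e1 \<equiv> axis 1 1"
abbreviation e2 :: "'a::field^2" where "e2 \<equiv> axis 2 1"

text \<open>The lists below enumerate the columns of the matrices of structure constants, hence the
  transposition.\<close>

definition structure_constants :: "('a::field^2 \<Rightarrow> 'a^2 \<Rightarrow> 'a^2) \<Rightarrow> 'a^4^2"
  where "structure_constants \<mu> = transpose (vector [\<mu> e1 e1, \<mu> e1 e2, \<mu> e2 e1, \<mu> e2 e2])"

definition structure_constants_3 :: "('a::field^2 \<Rightarrow> 'a^2 \<Rightarrow> 'a^2 \<Rightarrow> 'a^2) \<Rightarrow> 'a^8^2"
  where "structure_constants_3 f = transpose (vector
    [f e1 e1 e1, f e1 e1 e2, f e1 e2 e1, f e1 e2 e2,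
     f e2 e1 e1, f e2 e1 e2, f e2 e2 e1, f e2 e2 e2])"

definition algebra_of_matrix :: "'a::field^4^2 \<Rightarrow> 'a^2 \<Rightarrow> 'a^2 \<Rightarrow> 'a^2"
  where "algebra_of_matrix M x y =
    (x$1 * y$1) *s column 1 M + (x$1 * y$2) *s column 2 M +
    (x$2 * y$1) *s column 3 M + (x$2 * y$2) *s column 4 M"

definition A4 :: "'a::field \<Rightarrow> 'a \<Rightarrow> 'a^2 \<Rightarrow> 'a^2 \<Rightarrow> 'a^2"
  where "A4 \<alpha>\<^sub>1 \<beta>\<^sub>2 = algebra_of_matrix (vector
    [vector [\<alpha>\<^sub>1, 0, 0, 0],
     vector [0, \<beta>\<^sub>2, 1 - \<alpha>\<^sub>1, 0]])"

definition A5 :: "'a::field \<Rightarrow> 'a^2 \<Rightarrow> 'a^2 \<Rightarrow> 'a^2"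
  where "A5 \<alpha>\<^sub>1 = algebra_of_matrix (vector
    [vector [\<alpha>\<^sub>1, 0, 0, 0],
     vector [1, 2 * \<alpha>\<^sub>1 - 1, 1 - \<alpha>\<^sub>1, 0]])"

lemma linear_vec_iff:
  "linear_vec f \<longleftrightarrow> (\<forall>x y. f (x + y) = f x + f y) \<and> (\<forall>c x. f (c *s x) = c *s f x)"
  by (auto simp: Vector_Spaces.linear_iff vec.vector_space_axioms)

lemma vec2_decomp: "x = x$1 *s e1 + x$2 *s e2" for x :: "'a::field^2"
  by (simp add: vec_eq_iff forall_2 axis_def)

lemma bilinear_algebra_of_matrix: "bilinear_vec (algebra_of_matrix M)"
  by (simp add: bilinear_vec_def linear_vec_iff algebra_of_matrix_def vec_eq_iff algebra_simps)

lemma vector_4_nth: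
  "(vector [a, b, c, d] :: 'b::zero^4)$1 = a" "(vector [a, b, c, d] :: 'b::zero^4)$2 = b"
  "(vector [a, b, c, d] :: 'b::zero^4)$3 = c" "(vector [a, b, c, d] :: 'b::zero^4)$4 = d"
  by (simp_all add: vector_def)

text \<open>\<open>algebra_of_matrix M\<close> is the unique binary algebra whose matrix of structure constants
  is \<open>M\<close>.\<close>

lemma algebra_of_matrix_unique:
  "bilinear_vec \<mu> \<and> structure_constants \<mu> = M \<longleftrightarrow> \<mu> = algebra_of_matrix M"
proof
  assume *: "bilinear_vec \<mu> \<and> structure_constants \<mu> = M"
  show "\<mu> = algebra_of_matrix M"
  proof (intro ext)
    fix x y
    have "\<mu> x y = \<mu> (x$1 *s e1 + x$2 *s e2) (y$1 *s e1 + y$2 *s e2)"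
      by (simp flip: vec2_decomp)
    also have "\<dots> = (x$1 * y$1) *s \<mu> e1 e1 + (x$1 * y$2) *s \<mu> e1 e2 +
        (x$2 * y$1) *s \<mu> e2 e1 + (x$2 * y$2) *s \<mu> e2 e2"
      using * by (simp add: bilinear_vec_def linear_vec_iff vec_eq_iff algebra_simps)
    also have "\<dots> = algebra_of_matrix M x y"
    proof -
      have M: "M = structure_constants \<mu>"
        using * by simp
      show ?thesis
        unfolding M by (simp add: algebra_of_matrix_def structure_constants_def vec_eq_iff
            column_def transpose_def vector_4_nth)
    qed
    finally show "\<mu> x y = algebra_of_matrix M x y" .
  qed
next
  assume "\<mu> = algebra_of_matrix M"
  then show "bilinear_vec \<mu> \<and> structure_constants \<mu> = M"
    by (simp add: bilinear_algebra_of_matrix structure_constants_def algebra_of_matrix_def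
        vec_eq_iff forall_2 forall_4 transpose_def column_def vector_4_nth axis_def)
qed

lemma trilinear_generated_3_algebra:
  "bilinear_vec \<mu> \<Longrightarrow> trilinear_vec (generated_3_algebra \<mu>)"
  by (simp add: bilinear_vec_def trilinear_vec_def linear_vec_iff generated_3_algebra_def)

end

theory Submission
  imports Defs
begin

text \<open>
  Both coincidences of 3-algebras come from the coordinate formula for the triple product
  \<open>x (y z)\<close>. In \<open>A5 \<alpha>\<close>, which is \<open>A4 \<alpha> (2 * \<alpha> - 1)\<close> with the term \<open>x\<^sub>1 y\<^sub>1 e\<^sub>2\<close> added to the
  product, the triple product differs from that of \<open>A4 \<alpha> (2 * \<alpha> - 1)\<close> by
  \<open>(3 * \<alpha> - 1) x\<^sub>1 y\<^sub>1 z\<^sub>1 e\<^sub>2\<close>, so the two agree at \<open>\<alpha> = 1/3\<close>. In \<open>A4 1 \<beta>\<close> the triple product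
  depends on \<open>\<beta>\<close> only through \<open>\<beta>\<^sup>2\<close>, so the sign of \<open>\<beta>\<close> is lost.

  The binary algebras are told apart by two isomorphism invariants. In \<open>A4 \<alpha> (2 * \<alpha> - 1)\<close> the
  square of every vector is a multiple of that vector, whereas in \<open>A5 \<alpha>\<close> the square of \<open>e\<^sub>1\<close> has
  a component along \<open>e\<^sub>2\<close>. The algebra \<open>A4 1 1\<close> has the left identity \<open>e\<^sub>1\<close>, whereas a left
  identity of \<open>A4 1 (-1)\<close> would have first coordinate both \<open>1\<close> and \<open>-1\<close>, which differ outside
  characteristic 2.
\<close>

lemma A4_nth:
  "A4 \<alpha> \<beta> x y $ 1 = \<alpha> * (x$1 * y$1)"
  "A4 \<alpha> \<beta> x y $ 2 = \<beta> * (x$1 * y$2) + (1 - \<alpha>) * (x$2 * y$1)"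
  by (simp_all add: A4_def algebra_of_matrix_def column_def vector_4_nth mult.commute)

lemma A5_nth:
  "A5 \<alpha> x y $ 1 = \<alpha> * (x$1 * y$1)"
  "A5 \<alpha> x y $ 2 = x$1 * y$1 + (2 * \<alpha> - 1) * (x$1 * y$2) + (1 - \<alpha>) * (x$2 * y$1)"
  by (simp_all add: A5_def algebra_of_matrix_def column_def vector_4_nth mult.commute)

lemma exhaust_8:
  fixes x :: 8
  shows "x = 1 \<or> x = 2 \<or> x = 3 \<or> x = 4 \<or> x = 5 \<or> x = 6 \<or> x = 7 \<or> x = 8"
proof (induct x)
  case (of_int z)
  then have "z = 0 \<or> z = 1 \<or> z = 2 \<or> z = 3 \<or> z = 4 \<or> z = 5 \<or> z = 6 \<or> z = 7"
    by simp arith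
  then show ?case by auto
qed

lemma forall_8:
  "(\<forall>i::8. P i) \<longleftrightarrow> P 1 \<and> P 2 \<and> P 3 \<and> P 4 \<and> P 5 \<and> P 6 \<and> P 7 \<and> P 8"
  by (metis exhaust_8)

lemma vector_8_nth:
  "(vector [a, b, c, d, e, f, g, h] :: 'b::zero^8)$1 = a"
  "(vector [a, b, c, d, e, f, g, h] :: 'b::zero^8)$2 = b"
  "(vector [a, b, c, d, e, f, g, h] :: 'b::zero^8)$3 = c"
  "(vector [a, b, c, d, e, f, g, h] :: 'b::zero^8)$4 = d"
  "(vector [a, b, c, d, e, f, g, h] :: 'b::zero^8)$5 = e"
  "(vector [a, b, c, d, e, f, g, h] :: 'b::zero^8)$6 = f"
  "(vector [a, b, c, d, e, f, g, h] :: 'b::zero^8)$7 = g"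
  "(vector [a, b, c, d, e, f, g, h] :: 'b::zero^8)$8 = h"
  by (simp_all add: vector_def)

lemma generated_3_algebra_A4_nth:
  "generated_3_algebra (A4 \<alpha> \<beta>) x y z $ 1 = \<alpha>\<^sup>2 * (x$1 * y$1 * z$1)"
  "generated_3_algebra (A4 \<alpha> \<beta>) x y z $ 2 = \<beta>\<^sup>2 * (x$1 * y$1 * z$2) +
    \<beta> * (1 - \<alpha>) * (x$1 * y$2 * z$1) + \<alpha> * (1 - \<alpha>) * (x$2 * y$1 * z$1)"
  by (simp_all add: generated_3_algebra_def A4_nth power2_eq_square algebra_simps)

lemma structure_constants_3_A4:
  "structure_constants_3 (generated_3_algebra (A4 \<alpha> \<beta>)) =
    vector [vector [\<alpha>\<^sup>2, 0, 0, 0, 0, 0, 0, 0],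
            vector [0, \<beta>\<^sup>2, \<beta> * (1 - \<alpha>), 0, \<alpha> * (1 - \<alpha>), 0, 0, 0]]"
  unfolding structure_constants_3_def vec_eq_iff forall_2 forall_8 transpose_def
  by (simp only: vec_lambda_beta vector_8_nth vector_2 generated_3_algebra_A4_nth)
    (simp add: axis_def)

lemma generated_3_algebra_A4_1_uminus:
  "generated_3_algebra (A4 1 (-\<beta>)) = generated_3_algebra (A4 1 \<beta>)"
  by (simp add: fun_eq_iff vec_eq_iff forall_2 generated_3_algebra_A4_nth)

text \<open>The term \<open>x\<^sub>1 y\<^sub>1 e\<^sub>2\<close> enters the triple product twice: with coefficient \<open>2 * \<alpha> - 1\<close> through the
  inner product and with coefficient \<open>\<alpha>\<close> through the outer one. The condition on \<open>\<alpha>\<close> says that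
  these coefficients cancel.\<close>

lemma generated_3_algebra_A5:
  assumes "3 * \<alpha> = 1"
  shows "generated_3_algebra (A5 \<alpha>) = generated_3_algebra (A4 \<alpha> (2 * \<alpha> - 1))"
proof -
  have "generated_3_algebra (A5 \<alpha>) x y z $ 2 =
      generated_3_algebra (A4 \<alpha> (2 * \<alpha> - 1)) x y z $ 2 + (3 * \<alpha> - 1) * (x$1 * y$1 * z$1)" for x y z
    by (simp add: generated_3_algebra_def A4_nth A5_nth algebra_simps)
  then show ?thesis
    using assms
    by (simp add: fun_eq_iff vec_eq_iff forall_2) (simp add: generated_3_algebra_def A4_nth A5_nth)
qed

lemma isomorphic_algebras_squares_parallel:
  assumes "isomorphic_algebras \<mu> \<mu>'" and parallel: "\<And>x. \<exists>c. \<mu> x x = c *s x"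
  shows "\<exists>c. \<mu>' y y = c *s y"
proof -
  obtain \<phi> where \<phi>: "linear_vec \<phi>" "bij \<phi>" "\<And>x y. \<phi> (\<mu> x y) = \<mu>' (\<phi> x) (\<phi> y)"
    using assms(1) by (auto simp: isomorphic_algebras_def)
  obtain x where y: "y = \<phi> x"
    using \<phi>(2) by (metis bij_pointE)
  obtain c where "\<mu> x x = c *s x"
    using parallel by blast
  then have "\<mu>' y y = c *s y"
    using \<phi>(1) by (simp add: y linear_vec_iff flip: \<phi>(3))
  then show ?thesis ..
qed

lemma isomorphic_algebras_left_identity:
  assumes "isomorphic_algebras \<mu> \<mu>'" and "\<And>y. \<mu>' u y = y"
  shows "\<exists>v. \<forall>x. \<mu> v x = x"
proof -
  obtain \<phi> where \<phi>: "bij \<phi>" "\<And>x y. \<phi> (\<mu> x y) = \<mu>' (\<phi> x) (\<phi> y)"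
    using assms(1) by (auto simp: isomorphic_algebras_def)
  obtain v where "\<phi> v = u"
    using \<phi>(1) by (metis bij_pointE)
  then have "\<phi> (\<mu> v x) = \<phi> x" for x
    by (simp add: \<phi>(2) assms(2))
  then show ?thesis
    using \<phi>(1) by (metis bij_is_inj injD)
qed

text \<open>Since \<open>(2 * \<alpha> - 1) + (1 - \<alpha>) = \<alpha>\<close>, the square of \<open>x\<close> in \<open>A4 \<alpha> (2 * \<alpha> - 1)\<close> is
  \<open>\<alpha> x\<^sub>1 x\<close>.\<close>

lemma not_isomorphic_A4_A5:
  fixes \<alpha> :: "'a::field"
  shows "\<not> isomorphic_algebras (A4 \<alpha> (2 * \<alpha> - 1)) (A5 \<alpha>)"
proof
  assume iso: "isomorphic_algebras (A4 \<alpha> (2 * \<alpha> - 1)) (A5 \<alpha>)"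
  have "A4 \<alpha> (2 * \<alpha> - 1) x x = (\<alpha> * x$1) *s x" for x
    by (simp add: vec_eq_iff forall_2 A4_nth algebra_simps)
  then have "\<exists>c. A4 \<alpha> (2 * \<alpha> - 1) x x = c *s x" for x
    by blast
  from isomorphic_algebras_squares_parallel[OF iso this]
  obtain c where "A5 \<alpha> e1 e1 = c *s e1"
    by blast
  then have "A5 \<alpha> e1 e1 $ 2 = (c *s e1) $ 2"
    by simp
  then show False
    by (simp add: A5_nth axis_def)
qed

lemma not_isomorphic_A4_1:
  assumes "(2::'a::field) \<noteq> 0"
  shows "\<not> isomorphic_algebras (A4 1 (-1) :: 'a^2 \<Rightarrow> 'a^2 \<Rightarrow> 'a^2) (A4 1 1 :: 'a^2 \<Rightarrow> 'a^2 \<Rightarrow> 'a^2)"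
proof
  assume iso: "isomorphic_algebras (A4 1 (-1) :: 'a^2 \<Rightarrow> 'a^2 \<Rightarrow> 'a^2)
    (A4 1 1 :: 'a^2 \<Rightarrow> 'a^2 \<Rightarrow> 'a^2)"
  have "A4 1 1 e1 y = y" for y :: "'a^2"
    by (simp add: vec_eq_iff forall_2 A4_nth axis_def)
  from isomorphic_algebras_left_identity[OF iso this]
  obtain v :: "'a^2" where v: "\<And>x. A4 1 (-1) v x = x"
    by blast
  have "v$1 = 1"
    using arg_cong[OF v[of e1], of "\<lambda>w. w$1"] by (simp add: A4_nth axis_def)
  moreover have "- (v$1) = 1"
    using arg_cong[OF v[of e2], of "\<lambda>w. w$2"] by (simp add: A4_nth axis_def)
  ultimately have "(2::'a) = 0"
    by (metis add.right_inverse one_add_one)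
  with assms show False ..
qed

lemma of_nat_prime_neq_0:
  assumes "prime p" and "CHAR('a::idom) \<noteq> p"
  shows "(of_nat p :: 'a) \<noteq> 0"
proof
  assume "(of_nat p :: 'a) = 0"
  then have "CHAR('a) dvd p"
    by (simp only: of_nat_eq_0_iff_char_dvd)
  with assms(1) have "CHAR('a) = 1 \<or> CHAR('a) = p"
    unfolding prime_nat_iff by blast
  with assms(2) CHAR_not_1'[where 'a = 'a] show False
    by simp
qed

theorem mainTheorem2:
  assumes "CHAR('a::alg_closed_field) \<noteq> 2" and "CHAR('a) \<noteq> 3"
  shows
    "(\<not> isomorphic_algebras (A4 (1/3) (-1/3) :: 'a^2 \<Rightarrow> 'a^2 \<Rightarrow> 'a^2) (A5 (1/3) :: 'a^2 \<Rightarrow> 'a^2 \<Rightarrow> 'a^2) \<and>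
     generated_3_algebra (A4 (1/3) (-1/3) :: 'a^2 \<Rightarrow> 'a^2 \<Rightarrow> 'a^2) = generated_3_algebra (A5 (1/3)) \<and>
     structure_constants_3 (generated_3_algebra (A4 (1/3) (-1/3) :: 'a^2 \<Rightarrow> 'a^2 \<Rightarrow> 'a^2)) =
       vector [vector [1/9, 0, 0, 0, 0, 0, 0, 0],
               vector [0, 1/9, -2/9, 0, 2/9, 0, 0, 0]])
     \<and>
     (\<not> isomorphic_algebras (A4 1 (-1) :: 'a^2 \<Rightarrow> 'a^2 \<Rightarrow> 'a^2) (A4 1 1 :: 'a^2 \<Rightarrow> 'a^2 \<Rightarrow> 'a^2) \<and>
     generated_3_algebra (A4 1 (-1) :: 'a^2 \<Rightarrow> 'a^2 \<Rightarrow> 'a^2) = generated_3_algebra (A4 1 1) \<and>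
     structure_constants_3 (generated_3_algebra (A4 1 (-1) :: 'a^2 \<Rightarrow> 'a^2 \<Rightarrow> 'a^2)) =
       vector [vector [1, 0, 0, 0, 0, 0, 0, 0],
               vector [0, 1, 0, 0, 0, 0, 0, 0]])"
proof -
  have two: "(2::'a) \<noteq> 0"
    using of_nat_prime_neq_0[where 'a = 'a, of 2] assms(1) by simp
  have three: "(3::'a) \<noteq> 0"
    using of_nat_prime_neq_0[where 'a = 'a, of 3] assms(2) by simp
  have third: "3 * (1/3) = (1::'a)" and \<beta>: "2 * (1/3) - 1 = (-1/3 :: 'a)"
    and two_thirds: "1 - 1/3 = (2/3 :: 'a)"
    using three by (simp_all add: field_simps)
  have "structure_constants_3 (generated_3_algebra (A4 (1/3) (-1/3) :: 'a^2 \<Rightarrow> 'a^2 \<Rightarrow> 'a^2)) =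
      vector [vector [1/9, 0, 0, 0, 0, 0, 0, 0],
              vector [0, 1/9, -2/9, 0, 2/9, 0, 0, 0]]"
    unfolding structure_constants_3_A4 two_thirds by (simp add: power2_eq_square)
  moreover have "structure_constants_3 (generated_3_algebra (A4 1 (-1) :: 'a^2 \<Rightarrow> 'a^2 \<Rightarrow> 'a^2)) =
      vector [vector [1, 0, 0, 0, 0, 0, 0, 0],
              vector [0, 1, 0, 0, 0, 0, 0, 0]]"
    unfolding structure_constants_3_A4 by simp
  ultimately show ?thesis
    using not_isomorphic_A4_A5[of "1/3 :: 'a"] generated_3_algebra_A5[OF third]
      not_isomorphic_A4_1[OF two] generated_3_algebra_A4_1_uminus[of "1::'a"]
    unfolding \<beta> by simp
qed

end
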